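(* Let $F(x)=x^{k(q-1)}$ be a power mapping over $\mathbb{F}_{q^2}$, where $q=2^m$ and $m$, $k$ are positive integers with $\gcd(k,q+1)=1$. Then $F(x)$ is locally-APN. If $m$ is even, its differential spectrum is \[\mathbb{DS}_F=\{\omega_{0}=2^{2m-1}+2^{m-1}-2,\ \omega_{2}=2^{2m-1}-2^{m-1}+1,\ \omega_{2^m-2}=1\};\] and if $m$ is odd, its differential spectrum is \[\mathbb{DS}_F=\{\omega_{0}=2^{2m-1}+2^{m-1}-1,\ \omega_{2}=2^{2m-1}-2^{m-1}-1,\ \omega_{4}=1,\ \omega_{2^m-2}=1\}.\]
   Context: For a function $F:\mathbb{F}_{p^n}\to\mathbb{F}_{p^n}$ ($p$ prime), $a\in\mathbb{F}_{p^n}^*$ and $b\in\mathbb{F}_{p^n}$, let $\delta_F(a,b)=|\{x\in\mathbb{F}_{p^n}: F(x+a)-F(x)=b\}|$, and let $\delta(F)=\max_{a\in\mathbb{F}_{p^n}^*}\max_{b\in\mathbb{F}_{p^n}}\delta_F(a,b)$. Here $p=2$ and $n=2m$, so $\mathbb{F}_{p^n}=\mathbb{F}_{q^2}$. For a power mapping $F$ with $\delta(F)=\delta$, the differential spectrum is $\mathbb{DS}_F=\{\omega_0,\omega_1,\ldots,\omega_\delta\}$, where $\omega_i=|\{b\in\mathbb{F}_{p^n}:\delta_F(1,b)=i\}|$ for $0\le i\le\delta$; entries not displayed are zero. A power function $F$ over $\mathbb{F}_{p^n}$ is said to be locally-APN if $\max\{\delta_F(1,b): b\in\mathbb{F}_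{p^n}\setminus\mathbb{F}_p\}=2$.
   Formalization: Locally-APN is claimed only for m ≥ 2: for m = 1, F is additive on F_4 and the maximum over b outside F_2 is 0, not 2. For m = 1, 2, where displayed indices coincide (2^m−2 equals 0 or 2), the entries listed under the same index are added. *)

theory Defs
  imports "HOL-Computational_Algebra.Computational_Algebra"
begin

definition diff_count :: "('a::finite_field \<Rightarrow> 'a) \<Rightarrow> 'a \<Rightarrow> 'a \<Rightarrow> nat" where
  "diff_count F a b = card {x. F (x + a) - F x = b}"

definition diff_uniformity :: "('a::finite_field \<Rightarrow> 'a) \<Rightarrow> nat" where
  "diff_uniformity F = Max ((\<lambda>a. Max (range (diff_count F a))) ` (UNIV - {0}))"

(* The family omega_0, ..., omega_delta with delta = diff_uniformity F, extended by 0
   to all indices. *)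
definition diff_spectrum :: "('a::finite_field \<Rightarrow> 'a) \<Rightarrow> nat \<Rightarrow> nat" where
  "diff_spectrum F i =
     (if i \<le> diff_uniformity F then card {b. diff_count F 1 b = i} else 0)"

(* The family with displayed entries omega_i = w for (i, w) in the list, all other entries
   being 0. Entries listed under the same index are added; for distinct indices this is
   just the list read as a function. *)
definition displayed_spectrum :: "(nat \<times> nat) list \<Rightarrow> nat \<Rightarrow> nat" where
  "displayed_spectrum ws i = (\<Sum>(j, w)\<leftarrow>ws. if j = i then w else 0)"

definition prime_subfield :: "'a::finite_field set" where
  "prime_subfield = range of_nat"

definition locally_APN :: "('a::finite_field \<Rightarrow> 'a) \<Rightarrow> bool" where
  "locally_APN F \<longleftrightarrow> Max (diff_count F 1 ` (UNIV - prime_subfield)) = 2"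

end

theory Submission
  imports Defs
begin

text \<open>
  For \<open>x \<noteq> 0, 1\<close> the values \<open>u = F x\<close> and \<open>v = F (x + 1)\<close> lie in the group of \<open>(q + 1)\<close>-st roots
  of unity, and \<open>x\<close> can be recovered from \<open>(u, v)\<close> when \<open>u \<noteq> v\<close>. If \<open>u + v = b \<noteq> 0\<close>, raising to
  the power \<open>q\<close> gives \<open>b ^ q * u * v = b\<close>, so \<open>u\<close> and \<open>v\<close> are the two roots of a fixed quadratic
  and the solutions \<open>x\<close> form at most one pair \<open>{x, x + 1}\<close>. The case \<open>b = 0\<close> yields exactly
  \<open>\<bbbF>\<^sub>q - {0, 1}\<close>, and \<open>b = 1\<close> gains the solutions \<open>0, 1\<close> and, precisely when \<open>3\<close> divides
  \<open>q + 1\<close>, the two primitive cube roots of unity. Counting the elements of the field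
  then determines the number of \<open>b\<close> with two solutions.
\<close>

section \<open>Powers, roots of unity and characteristic in finite fields\<close>

lemma coprime_powers_eq_1_imp_eq_1:
  fixes w :: "'a::monoid_mult"
  assumes "coprime a b" "a \<noteq> 0" "w ^ a = 1" "w ^ b = 1"
  shows "w = 1"
proof -
  obtain x y where "a * x = b * y + 1"
    using bezout_nat[OF assms(2), of b] assms(1) by auto
  then have "w ^ (a * x) = w ^ (b * y) * w"
    by (simp add: power_commutes)
  then show ?thesis
    using assms(3,4) by (simp add: power_mult)
qed

lemma card_power_eq_le:
  fixes c :: "'a::idom"
  assumes "n > 0"
  shows "card {x. x ^ n = c} \<le> n"
proof -
  define p where "p = monom 1 n + [:-c:]"
  have deg: "degree p = n"
    unfolding p_def using assms by (subst degree_add_eq_left) (auto simp: degree_monom_eq)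
  then have "p \<noteq> 0"
    using assms by auto
  then have "card {x. poly p x = 0} \<le> n"
    using card_poly_roots_bound deg by metis
  then show ?thesis
    by (simp add: p_def poly_monom)
qed

lemma card_eq_sum_card_fibres:
  assumes "finite S" "finite T" "g ` S \<subseteq> T"
  shows "card S = (\<Sum>y\<in>T. card {x \<in> S. g x = y})"
  using sum.group[OF assms, of "\<lambda>_. 1 :: nat"] by simp

lemma finite_field_power_card_minus_1:
  fixes x :: "'a::finite_field"
  assumes "x \<noteq> 0"
  shows "x ^ (card (UNIV :: 'a set) - 1) = 1"
proof -
  have "x * x ^ (card (UNIV :: 'a set) - 1) = x"
    using finite_field_power_card_eq_same[of x] finite_UNIV_card_ge_0[where ?'a = 'a]
    by (metis finite_class.finite_UNIV power_eq_if not_gr_zero)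
  then show ?thesis
    using assms by simp
qed

lemma even_card_imp_CHAR_2:
  assumes "even (card (UNIV :: 'a::finite_field set))"
  shows "CHAR('a) = 2"
proof -
  \<comment> \<open>An even power of \<open>-1\<close> is \<open>1\<close>, while the power
    \<open>card UNIV\<close> fixes every element.\<close>
  have "(-1 :: 'a) = 1"
    using finite_field_power_card_eq_same[of "-1 :: 'a"] assms by simp
  then have "of_nat 2 = (0 :: 'a)"
    by (metis add.right_inverse of_nat_numeral one_add_one)
  then have "CHAR('a) dvd 2"
    using of_nat_eq_0_iff_char_dvd by blast
  moreover have "CHAR('a) > 0"
    by (simp add: finite_imp_CHAR_pos)
  ultimately show ?thesis
    using primes_dvd_imp_eq[OF prime_CHAR_semidom two_is_prime_nat] by blast
qed

text \<open>The degree bounds the count from above. From below, the \<open>e\<close>-th power sends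
  the \<open>d * e\<close> nonzero elements into the \<open>d\<close>-th roots of unity with fibres
  of size at most \<open>e\<close>.\<close>

lemma card_roots_of_unity_finite_field:
  assumes "card (UNIV :: 'a::finite_field set) - 1 = d * e" "d > 0" "e > 0"
  shows "card {z :: 'a. z ^ d = 1} = d"
proof (rule antisym)
  let ?S = "UNIV - {0 :: 'a}" and ?T = "{z :: 'a. z ^ d = 1}"
  show "card ?T \<le> d"
    using card_power_eq_le assms(2) by blast
  have "(\<lambda>x. x ^ e) ` ?S \<subseteq> ?T"
  proof safe
    fix x :: 'a assume "x \<noteq> 0"
    then show "(x ^ e) ^ d = 1"
      using finite_field_power_card_minus_1[of x] assms(1)
      by (simp flip: power_mult add: mult.commute)
  qed
  then have "card ?S = (\<Sum>y\<in>?T. card {x \<in> ?S. x ^ e = y})"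
    by (intro card_eq_sum_card_fibres) auto
  also have "\<dots> \<le> (\<Sum>y\<in>?T. e)"
  proof (rule sum_mono)
    fix y :: 'a
    have "card {x \<in> ?S. x ^ e = y} \<le> card {x. x ^ e = y}"
      by (intro card_mono) auto
    also have "\<dots> \<le> e"
      using card_power_eq_le assms(3) by blast
    finally show "card {x \<in> ?S. x ^ e = y} \<le> e" .
  qed
  finally have "d * e \<le> card ?T * e"
    using assms(1) by (simp add: card_Diff_subset)
  then show "d \<le> card ?T"
    using assms(3) by simp
qed

section \<open>Spectrum and prime subfield for general maps\<close>

lemma diff_spectrum_eq_card:
  fixes F :: "'a::finite_field \<Rightarrow> 'a"
  shows "diff_spectrum F i = card {b. diff_count F 1 b = i}"
proof (cases "i \<le> diff_uniformity F")
  case False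
  \<comment> \<open>The maximum \<open>diff_uniformity F\<close> includes \<open>a = 1\<close>, so
    the cutoff in \<open>diff_spectrum\<close> loses nothing.\<close>
  have "diff_count F 1 b \<le> diff_uniformity F" for b
  proof -
    have "diff_count F 1 b \<le> Max (range (diff_count F 1))"
      by (intro Max_ge) auto
    also have "\<dots> \<le> diff_uniformity F"
      unfolding diff_uniformity_def by (intro Max_ge) auto
    finally show ?thesis .
  qed
  with False have "{b. diff_count F 1 b = i} = {}"
    by auto
  with False show ?thesis
    by (simp add: diff_spectrum_def)
qed (simp add: diff_spectrum_def)

lemma prime_subfield_CHAR_2:
  assumes "CHAR('a::finite_field) = 2"
  shows "prime_subfield = {0, 1 :: 'a}"
proof
  have "(1 :: 'a) + 1 = 0"
    using of_nat_CHAR[where ?'a = 'a] assms by simp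
  then have "of_nat n \<in> {0, 1 :: 'a}" for n
    by (induction n) auto
  then show "prime_subfield \<subseteq> {0, 1 :: 'a}"
    unfolding prime_subfield_def by blast
  have "of_nat 0 \<in> (prime_subfield :: 'a set)" "of_nat 1 \<in> (prime_subfield :: 'a set)"
    unfolding prime_subfield_def by blast+
  then show "{0, 1 :: 'a} \<subseteq> prime_subfield"
    by simp
qed

section \<open>The power map and arithmetic in characteristic 2\<close>

locale niho_power =
  fixes F :: "'a::finite_field \<Rightarrow> 'a" and m k q :: nat
  assumes m_pos: "m > 0" and k_pos: "k > 0"
    and q_def: "q = 2 ^ m"
    and card_UNIV: "card (UNIV :: 'a set) = q ^ 2"
    and coprime_k: "coprime k (q + 1)"
    and F_def: "F = (\<lambda>x. x ^ (k * (q - 1)))"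
begin

lemma q_ge_2: "q \<ge> 2"
  using m_pos self_le_power[of 2 m] by (simp add: q_def)

lemma card_minus_1: "card (UNIV :: 'a set) - 1 = (q - 1) * (q + 1)"
  by (simp add: card_UNIV power2_eq_square algebra_simps)

lemma CHAR_2: "CHAR('a) = 2"
  by (rule even_card_imp_CHAR_2) (use m_pos in \<open>simp add: card_UNIV q_def\<close>)

lemma minus_eq_add: "x - y = x + (y :: 'a)"
  by (rule minus_CHAR_2) (rule CHAR_2)

lemma add_self [simp]: "x + x = (0 :: 'a)" "x + (x + y) = (y :: 'a)"
  by (metis minus_eq_add diff_self) (metis minus_eq_add diff_add_cancel add.commute)

lemma add_eq_0_iff_eq: "x + y = (0 :: 'a) \<longleftrightarrow> x = y"
  by (metis minus_eq_add right_minus_eq)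

lemma frobenius: "(x + y) ^ q = x ^ q + (y :: 'a) ^ q"
  by (rule freshmans_dream'[where n = m]) (simp_all add: CHAR_2 q_def)

lemma power_q: "x ^ q = x * (x :: 'a) ^ (q - 1)"
  using q_ge_2 by (metis power_eq_if not_numeral_le_zero)

lemma root_of_unity: "x \<noteq> 0 \<Longrightarrow> ((x :: 'a) ^ (q - 1)) ^ (q + 1) = 1"
  using finite_field_power_card_minus_1[of x] unfolding card_minus_1 by (metis power_mult)

lemma F_root_of_unity: "x \<noteq> 0 \<Longrightarrow> F x ^ (q + 1) = 1"
  using root_of_unity[of x] unfolding F_def
  by (metis power_mult mult.commute mult.left_commute power_one)

lemma F_0 [simp]: "F 0 = 0"
  using q_ge_2 k_pos by (simp add: F_def)

lemma F_1 [simp]: "F 1 = 1"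
  by (simp add: F_def)

text \<open>The quotient of the two sides is a \<open>(q + 1)\<close>-st root of unity whose
  \<open>k\<close>-th power is \<open>1\<close>, and \<open>k\<close> is coprime to
  \<open>q + 1\<close>.\<close>

lemma F_eq_imp:
  assumes "x \<noteq> 0" "y \<noteq> 0" "F x = F y"
  shows "x ^ (q - 1) = y ^ (q - 1)"
proof -
  let ?w = "x ^ (q - 1) / y ^ (q - 1)"
  have "?w ^ k = F x / F y"
    by (simp add: F_def power_divide flip: power_mult) (simp add: mult.commute)
  also have "\<dots> = 1"
    using assms by (simp add: F_def)
  finally have "?w ^ k = 1" .
  moreover have "?w ^ (q + 1) = 1"
    using root_of_unity assms(1,2) by (simp add: power_divide del: power_Suc)
  ultimately have "?w = 1"
    using coprime_powers_eq_1_imp_eq_1 coprime_k k_pos by blast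
  then show ?thesis
    by simp
qed

section \<open>Solution sets of \<open>F (x + 1) + F x = b\<close>\<close>

text \<open>The solutions \<open>0\<close> and \<open>1\<close> are set aside because \<open>F\<close> leaves the roots of unity at \<open>0\<close>.\<close>
definition solutions :: "'a \<Rightarrow> 'a set" where
  "solutions b = {x. x \<noteq> 0 \<and> x \<noteq> 1 \<and> F (x + 1) + F x = b}"

lemma solutions_add_1: "x \<in> solutions b \<Longrightarrow> x + 1 \<in> solutions b"
  by (auto simp: solutions_def add_eq_0_iff_eq add_ac)

lemma solutions_0: "solutions 0 = {x. x ^ (q - 1) = 1} - {1}"
proof (intro equalityI subsetI)
  fix x assume "x \<in> solutions 0"
  then have x: "x \<noteq> 0" "x + 1 \<noteq> 0" "x \<noteq> 1" "F (x + 1) = F x"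
    by (simp_all add: solutions_def add_eq_0_iff_eq)
  define u where "u = x ^ (q - 1)"
  have u: "(x + 1) ^ (q - 1) = u"
    unfolding u_def using x by (intro F_eq_imp)
  \<comment> \<open>Both sides are \<open>(x + 1) ^ q\<close>, expanded by \<open>power_q\<close>
    and by \<open>frobenius\<close>.\<close>
  have "(x + 1) * u = x * u + 1"
    using frobenius[of x 1] u by (simp add: power_q u_def)
  then have "u = 1"
    by (simp add: algebra_simps)
  then show "x \<in> {x. x ^ (q - 1) = 1} - {1}"
    using x by (simp add: u_def)
next
  fix x assume "x \<in> {x. x ^ (q - 1) = 1} - {1 :: 'a}"
  then have x: "x ^ (q - 1) = 1" "x \<noteq> 1"
    by auto
  have "x \<noteq> 0"
    using x q_ge_2 by (auto simp: power_0_left split: if_splits)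
  have "(x + 1) * (x + 1) ^ (q - 1) = x + 1"
    using frobenius[of x 1] x by (simp add: power_q)
  then have "(x + 1) ^ (q - 1) = 1"
    using x(2) by (simp add: add_eq_0_iff_eq)
  then have "F (x + 1) = 1" "F x = 1"
    using x by (simp_all add: F_def mult.commute[of k] power_mult)
  then show "x \<in> solutions 0"
    using \<open>x \<noteq> 0\<close> x(2) by (simp add: solutions_def)
qed

text \<open>With \<open>u\<close>, \<open>v\<close> the \<open>(q - 1)\<close>-st powers of
  \<open>x\<close>, \<open>x + 1\<close>, expanding \<open>(x + 1) ^ q\<close> gives
  \<open>(x + 1) * v = x * u + 1\<close>. This is linear in \<open>x\<close> and has a single
  solution, since \<open>b \<noteq> 0\<close> forces \<open>u \<noteq> v\<close>.\<close>

lemma solution_determined: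
  assumes "x \<in> solutions b" "y \<in> solutions b" "b \<noteq> 0" "F y = F x"
  shows "y = x"
proof -
  have xy: "x \<noteq> 0" "y \<noteq> 0" "x + 1 \<noteq> 0" "y + 1 \<noteq> 0"
    using assms(1,2) by (simp_all add: solutions_def add_eq_0_iff_eq)
  have "F (y + 1) = F (x + 1)"
    using assms(1,2,4) by (simp add: solutions_def) (metis add_right_cancel)
  define u v where "u = x ^ (q - 1)" and "v = (x + 1) ^ (q - 1)"
  have uv: "y ^ (q - 1) = u" "(y + 1) ^ (q - 1) = v"
    unfolding u_def v_def using xy assms(4) \<open>F (y + 1) = F (x + 1)\<close> by (blast intro: F_eq_imp)+
  have "u \<noteq> v"
  proof
    assume "u = v"
    then have "F (x + 1) = F x"
      by (simp add: F_def u_def v_def mult.commute[of k] power_mult)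
    then show False
      using assms(1,3) by (simp add: solutions_def)
  qed
  have "(x + 1) * v = x * u + 1" "(y + 1) * v = y * u + 1"
    using frobenius[of x 1] frobenius[of y 1] uv by (simp_all add: power_q u_def v_def)
  then have "(x - y) * (u - v) = 0"
    by algebra
  then show ?thesis
    using \<open>u \<noteq> v\<close> by simp
qed

text \<open>The \<open>q\<close>-th power inverts \<open>(q + 1)\<close>-st roots of unity, so
  \<open>b = u + v\<close> gives \<open>b ^ q = 1 / u + 1 / v = b / (u * v)\<close>.\<close>

lemma F_quadratic:
  assumes "x \<in> solutions b"
  shows "b ^ q * (F x * (F x + b)) = b"
proof -
  define u v where "u = F x" and "v = F (x + 1)"
  have "u ^ (q + 1) = 1" "v ^ (q + 1) = 1"
    using assms F_root_of_unity by (auto simp: u_def v_def solutions_def add_eq_0_iff_eq)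
  then have uv: "u ^ q * u = 1" "v ^ q * v = 1"
    by (simp_all add: mult.commute)
  have b: "b = u + v"
    using assms by (simp add: u_def v_def solutions_def add.commute)
  have "b ^ q * (u * v) = (u ^ q * u) * v + (v ^ q * v) * u"
    by (simp add: b frobenius algebra_simps)
  then show ?thesis
    using uv by (simp add: b add.commute flip: u_def)
qed

lemma solutions_eq_pair:
  assumes "b \<noteq> 0" "x \<in> solutions b"
  shows "solutions b = {x, x + 1}"
proof
  show "solutions b \<subseteq> {x, x + 1}"
  proof
    fix y assume y: "y \<in> solutions b"
    have "F x * (F x + b) = F y * (F y + b)"
      using F_quadratic[OF assms(2)] F_quadratic[OF y] assms(1)
      by (metis mult_left_cancel power_not_zero)
    \<comment> \<open>\<open>t * (t + b)\<close> takes equal values at \<open>t = F x\<close> and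
      \<open>t = F y\<close>, and the difference of these values factors.\<close>
    then have "(F y - F x) * (F y + F x + b) = 0"
      by algebra
    then consider "F y = F x" | "F y = F x + b"
      by (auto simp: add_eq_0_iff_eq add.assoc)
    then show "y \<in> {x, x + 1}"
    proof cases
      case 1
      then show ?thesis
        using solution_determined[OF assms(2) y assms(1)] by simp
    next
      case 2
      have "F (x + 1) = F x + b"
        using assms(2) by (auto simp: solutions_def add_ac)
      with 2 show ?thesis
        using solution_determined[OF solutions_add_1[OF assms(2)] y assms(1)] by simp
    qed
  qed
  show "{x, x + 1} \<subseteq> solutions b"
    using assms(2) solutions_add_1 by auto
qed

lemma card_solutions:
  assumes "b \<noteq> 0"
  shows "card (solutions b) = (if solutions b = {} then 0 else 2)"
proof (cases "solutions b = {}")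
  case False
  then obtain x where "x \<in> solutions b"
    by blast
  moreover have "x \<noteq> x + 1"
    by simp
  ultimately show ?thesis
    using solutions_eq_pair[OF assms, of x] by (metis card_2_iff insert_not_empty)
qed simp

section \<open>Differential counts at \<open>0\<close>, at \<open>1\<close> and elsewhere\<close>

lemma diff_count_eq:
  "diff_count F 1 b = card (solutions b) + (if b = 1 then 2 else 0)"
proof -
  \<comment> \<open>The difference is \<open>1\<close> at \<open>x = 0\<close> and also at
    \<open>x = 1\<close>, the latter because \<open>-1 = 1\<close>.\<close>
  have "{x. F (x + 1) - F x = b} = solutions b \<union> (if b = 1 then {0, 1} else {})"
    by (auto simp: solutions_def minus_eq_add)
  moreover have "solutions b \<inter> (if b = 1 then {0, 1} else {}) = {}"
    by (auto simp: solutions_def)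
  ultimately show ?thesis
    by (simp add: diff_count_def card_Un_disjoint)
qed

lemma diff_count_0: "diff_count F 1 0 = q - 2"
proof -
  have "card {x :: 'a. x ^ (q - 1) = 1} = q - 1"
    by (rule card_roots_of_unity_finite_field[OF card_minus_1]) (use q_ge_2 in auto)
  then show ?thesis
    by (simp add: diff_count_eq solutions_0 card_Diff_singleton)
qed

lemma diff_count_other:
  "b \<noteq> 0 \<Longrightarrow> b \<noteq> 1 \<Longrightarrow> diff_count F 1 b = 0 \<or> diff_count F 1 b = 2"
  using card_solutions[of b] by (simp add: diff_count_eq)

text \<open>\<open>2\<close> is \<open>-1\<close> modulo \<open>3\<close>. This decides whether
  primitive cube roots of unity occur among the \<open>(q + 1)\<close>-st roots of unity.\<close>

lemma three_dvd_q_plus_1_iff: "3 dvd q + 1 \<longleftrightarrow> odd m"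
proof -
  have "3 dvd (2 :: nat) ^ n + 1 \<longleftrightarrow> odd n" for n
  proof (induction n rule: induct_nat_012)
    case (ge2 n)
    have "(2 :: nat) ^ Suc (Suc n) + 1 = (2 ^ n + 1) + 3 * 2 ^ n"
      by simp
    then have "3 dvd (2 :: nat) ^ Suc (Suc n) + 1 \<longleftrightarrow> 3 dvd (2 :: nat) ^ n + 1"
      by (metis dvd_add_left_iff dvd_triv_left)
    with ge2 show ?case
      by simp
  qed (simp_all add: numeral_2_eq_2[symmetric] del: One_nat_def)
  then show ?thesis
    by (simp add: q_def)
qed

text \<open>For \<open>b = 1\<close> the quadratic makes \<open>F x\<close> a primitive cube root of
  unity, which is no \<open>(q + 1)\<close>-st root of unity when \<open>3\<close> is coprime to
  \<open>q + 1\<close>.\<close>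

lemma solutions_1_empty:
  assumes "even m"
  shows "solutions 1 = {}"
proof (rule equals0I)
  fix x assume x: "x \<in> solutions 1"
  define u where "u = F x"
  have "u * (u + 1) = 1"
    using F_quadratic[OF x] by (simp add: u_def)
  moreover have "u ^ 3 - 1 = (u - 1) * (u * (u + 1) + 1)"
    by (simp add: power3_eq_cube algebra_simps)
  ultimately have "u ^ 3 = 1"
    by simp
  moreover have "u ^ (q + 1) = 1"
    using x F_root_of_unity by (auto simp: u_def solutions_def)
  moreover have "coprime 3 (q + 1)"
    using assms three_dvd_q_plus_1_iff by (intro prime_imp_coprime) (auto simp: prime_nat_numeral_eq)
  ultimately have "u = 1"
    using coprime_powers_eq_1_imp_eq_1[of 3 "q + 1" u] by simp
  with \<open>u * (u + 1) = 1\<close> show False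
    by simp
qed

text \<open>A primitive cube root of unity \<open>w\<close> is a solution:
  \<open>w + 1 = w ^ 2\<close>, and as \<open>3\<close> does not divide the exponent of
  \<open>F\<close>, the value \<open>v = F w\<close> is again primitive, with
  \<open>v ^ 2 + v = 1\<close>.\<close>

lemma solutions_1_nonempty:
  assumes "odd m"
  shows "solutions 1 \<noteq> {}"
proof -
  obtain c where c: "q + 1 = 3 * c"
    using assms three_dvd_q_plus_1_iff by blast
  have "card (UNIV :: 'a set) - 1 = 3 * ((q - 1) * c)"
    unfolding card_minus_1 c by simp
  then have "card {z :: 'a. z ^ 3 = 1} = 3"
    by (rule card_roots_of_unity_finite_field) (use c q_ge_2 in auto)
  then have "\<not> {z :: 'a. z ^ 3 = 1} \<subseteq> {1}"
    using card_mono[of "{1 :: 'a}" "{z. z ^ 3 = 1}"] by auto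
  then obtain w :: 'a where w: "w ^ 3 = 1" "w \<noteq> 1"
    by blast
  have "(w - 1) * (w ^ 2 + w + 1) = 0"
    using w(1) by (simp add: power2_eq_square power3_eq_cube algebra_simps)
  then have quad: "w ^ 2 + w + 1 = 0"
    using w(2) by simp
  have w2: "w + 1 = w ^ 2"
    using quad by (simp add: add_eq_0_iff_eq add.assoc)
  have "\<not> 3 dvd k"
  proof
    assume "3 dvd k"
    then have "3 dvd (1 :: nat)"
      using c coprime_k coprime_common_divisor[of k "q + 1" 3] by simp
    then show False
      by simp
  qed
  \<comment> \<open>\<open>q + 1\<close> is a multiple of \<open>3\<close>, so \<open>q - 1\<close>
    is \<open>1\<close> modulo \<open>3\<close>.\<close>
  moreover have "\<not> 3 dvd q - 1"
    using c q_ge_2 by presburger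
  ultimately have "\<not> 3 dvd k * (q - 1)"
    by (simp add: prime_dvd_mult_iff prime_nat_numeral_eq)
  then have "coprime 3 (k * (q - 1))"
    by (intro prime_imp_coprime) (auto simp: prime_nat_numeral_eq)
  define v where "v = F w"
  have "v \<noteq> 1"
    using coprime_powers_eq_1_imp_eq_1[OF \<open>coprime 3 (k * (q - 1))\<close>] w by (auto simp: v_def F_def)
  have "v ^ 3 = 1"
    by (metis F_def mult.commute power_mult power_one v_def w(1))
  then have "(v - 1) * (v ^ 2 + v + 1) = 0"
    by (simp add: power2_eq_square power3_eq_cube algebra_simps)
  then have "v ^ 2 + v = 1"
    using \<open>v \<noteq> 1\<close> by (simp add: add_eq_0_iff_eq)
  moreover have "F (w + 1) = v ^ 2"
    unfolding w2 v_def F_def by (simp add: mult.commute flip: power_mult)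
  moreover have "w \<noteq> 0"
    using w(1) by auto
  ultimately have "w \<in> solutions 1"
    using w(2) by (simp add: solutions_def v_def)
  then show ?thesis
    by blast
qed

lemma diff_count_1: "diff_count F 1 1 = (if even m then 2 else 4)"
  using solutions_1_empty solutions_1_nonempty card_solutions[of 1] by (simp add: diff_count_eq)

section \<open>Counting the \<open>b\<close> without solutions and those with two\<close>

definition "unsolvable = {b. b \<noteq> 0 \<and> b \<noteq> 1 \<and> diff_count F 1 b = 0}"
definition "solvable = {b. b \<noteq> 0 \<and> b \<noteq> 1 \<and> diff_count F 1 b = 2}"

lemma UNIV_split: "UNIV = {0} \<union> {1} \<union> unsolvable \<union> solvable"
  using diff_count_other by (auto simp: unsolvable_def solvable_def)

lemma sum_split:
  fixes h :: "'a \<Rightarrow> nat"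
  shows "(\<Sum>b\<in>UNIV. h b) = h 0 + h 1 + sum h unsolvable + sum h solvable"
  unfolding UNIV_split
  by (subst sum.union_disjoint; auto simp: unsolvable_def solvable_def)+

lemma card_unsolvable_solvable: "2 + card unsolvable + card solvable = q ^ 2"
  using sum_split[of "\<lambda>_. 1"] by (simp add: card_UNIV)

text \<open>Double counting: each \<open>x\<close> has exactly one difference, so the counts over
  all \<open>b\<close> add up to \<open>q ^ 2\<close>.\<close>

lemma card_solvable: "q - 2 + (if even m then 2 else 4) + 2 * card solvable = q ^ 2"
proof -
  have "q ^ 2 = (\<Sum>b\<in>UNIV. diff_count F 1 b)"
    using card_eq_sum_card_fibres[of UNIV UNIV "\<lambda>x. F (x + 1) - F x"]
    by (simp add: diff_count_def card_UNIV)
  also have "\<dots> = q - 2 + (if even m then 2 else 4) + 2 * card solvable"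
    by (simp add: sum_split diff_count_0 diff_count_1) (simp add: unsolvable_def solvable_def)
  finally show ?thesis ..
qed

text \<open>A sum of indicators, because indices can coincide: \<open>q - 2\<close> is
  \<open>0\<close> for \<open>m = 1\<close> and \<open>2\<close> for \<open>m = 2\<close>.
  \<open>displayed_spectrum\<close> adds such entries likewise.\<close>

lemma diff_spectrum_eq:
  "diff_spectrum F i = (if q - 2 = i then 1 else 0) + (if (if even m then 2 else 4) = i then 1 else 0)
     + (if 0 = i then card unsolvable else 0) + (if 2 = i then card solvable else 0)"
proof -
  have "diff_spectrum F i = (\<Sum>b\<in>UNIV. if diff_count F 1 b = i then 1 else 0)"
    by (simp add: diff_spectrum_eq_card sum.If_cases)
  also have "\<dots> = (if q - 2 = i then 1 else 0) + (if (if even m then 2 else 4) = i then 1 else 0)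
     + (\<Sum>b\<in>unsolvable. if 0 = i then 1 else 0) + (\<Sum>b\<in>solvable. if 2 = i then 1 else 0)"
    unfolding sum_split diff_count_0 diff_count_1
    by (intro arg_cong2[where f = "(+)"] sum.cong) (auto simp: unsolvable_def solvable_def)
  finally show ?thesis
    by simp
qed

lemma powers_of_2:
  shows "q = 2 * 2 ^ (m - 1)" and "2 ^ (2 * m - 1) = 2 * (2 ^ (m - 1) :: nat) ^ 2"
proof -
  obtain n where "m = Suc n"
    using m_pos gr0_implies_Suc by blast
  then show "q = 2 * 2 ^ (m - 1)" "2 ^ (2 * m - 1) = 2 * (2 ^ (m - 1) :: nat) ^ 2"
    by (simp_all add: q_def power_even_eq)
qed

lemma class_sizes_even:
  assumes "even m"
  shows "card solvable = 2 ^ (2 * m - 1) - 2 ^ (m - 1)"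
    and "card unsolvable = 2 ^ (2 * m - 1) + 2 ^ (m - 1) - 2"
proof -
  define r :: nat where "r = 2 ^ (m - 1)"
  have q: "q = 2 * r" and p: "2 ^ (2 * m - 1) = 2 * r ^ 2"
    using powers_of_2 by (simp_all add: r_def)
  \<comment> \<open>These bounds keep the natural-number subtractions from truncating; all else is
    linear in \<open>r\<close> and \<open>r ^ 2\<close>.\<close>
  have "r \<le> r ^ 2" "r \<ge> 1"
    by (simp_all add: r_def power2_eq_square)
  moreover have "2 * r + 2 * card solvable = 4 * r ^ 2"
    using card_solvable assms q_ge_2 by (simp add: q power_mult_distrib)
  moreover have "2 + card unsolvable + card solvable = 4 * r ^ 2"
    using card_unsolvable_solvable by (simp add: q power_mult_distrib)
  ultimately show "card solvable = 2 ^ (2 * m - 1) - 2 ^ (m - 1)"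
    and "card unsolvable = 2 ^ (2 * m - 1) + 2 ^ (m - 1) - 2"
    unfolding p r_def[symmetric] by linarith+
qed

lemma class_sizes_odd:
  assumes "odd m"
  shows "card solvable = 2 ^ (2 * m - 1) - 2 ^ (m - 1) - 1"
    and "card unsolvable = 2 ^ (2 * m - 1) + 2 ^ (m - 1) - 1"
proof -
  define r :: nat where "r = 2 ^ (m - 1)"
  have q: "q = 2 * r" and p: "2 ^ (2 * m - 1) = 2 * r ^ 2"
    using powers_of_2 by (simp_all add: r_def)
  have "r \<le> r ^ 2" "r \<ge> 1"
    by (simp_all add: r_def power2_eq_square)
  moreover have "2 * r + 2 + 2 * card solvable = 4 * r ^ 2"
    using card_solvable assms q_ge_2 by (simp add: q power_mult_distrib)
  moreover have "2 + card unsolvable + card solvable = 4 * r ^ 2"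
    using card_unsolvable_solvable by (simp add: q power_mult_distrib)
  ultimately show "card solvable = 2 ^ (2 * m - 1) - 2 ^ (m - 1) - 1"
    and "card unsolvable = 2 ^ (2 * m - 1) + 2 ^ (m - 1) - 1"
    unfolding p r_def[symmetric] by linarith+
qed

text \<open>Otherwise \<open>card_solvable\<close> gives \<open>q ^ 2 \<le> q + 2\<close>, which
  fails from \<open>q = 4\<close> on. For \<open>m = 1\<close> the set is empty:
  \<open>b = 1\<close> already accounts for all four elements.\<close>

lemma solvable_nonempty:
  assumes "m \<ge> 2"
  shows "solvable \<noteq> {}"
proof
  assume "solvable = {}"
  then have "q ^ 2 \<le> q + 2"
    using card_solvable q_ge_2 by (simp split: if_splits)
  moreover have "q \<ge> 4"
    using power_increasing[OF assms, of "2 :: nat"] by (simp add: q_def)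
  then have "q * 4 \<le> q ^ 2"
    by (simp add: power2_eq_square)
  ultimately show False
    using \<open>q \<ge> 4\<close> by linarith
qed

lemma locally_APN:
  assumes "m \<ge> 2"
  shows "locally_APN F"
  unfolding locally_APN_def prime_subfield_CHAR_2[OF CHAR_2]
proof (rule Max_eqI)
  show "2 \<in> diff_count F 1 ` (UNIV - {0, 1})"
    using solvable_nonempty[OF assms] by (force simp: solvable_def)
qed (use diff_count_other in force)+

end

theorem theorem1:
  fixes F :: "'a::finite_field \<Rightarrow> 'a" and m k q :: nat
  assumes "m > 0" and "k > 0"
    and "q = 2 ^ m"
    and "card (UNIV :: 'a set) = q ^ 2"
    and "coprime k (q + 1)"
    and "F = (\<lambda>x. x ^ (k * (q - 1)))"
  shows "(m \<ge> 2 \<longrightarrow> locally_APN F) \<and>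
    (even m \<longrightarrow> diff_spectrum F = displayed_spectrum
        [(0, 2 ^ (2 * m - 1) + 2 ^ (m - 1) - 2),
         (2, 2 ^ (2 * m - 1) - 2 ^ (m - 1) + 1),
         (2 ^ m - 2, 1)]) \<and>
    (odd m \<longrightarrow> diff_spectrum F = displayed_spectrum
        [(0, 2 ^ (2 * m - 1) + 2 ^ (m - 1) - 1),
         (2, 2 ^ (2 * m - 1) - 2 ^ (m - 1) - 1),
         (4, 1),
         (2 ^ m - 2, 1)])"
  proof -
  interpret niho_power F m k q
    by standard (use assms in auto)
  have "diff_spectrum F = displayed_spectrum
        [(0, 2 ^ (2 * m - 1) + 2 ^ (m - 1) - 2),
         (2, 2 ^ (2 * m - 1) - 2 ^ (m - 1) + 1),
         (2 ^ m - 2, 1)]" if "even m"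
    \<comment> \<open>The \<open>+ 1\<close> at index \<open>2\<close> comes from
      \<open>b = 1\<close>, which lies outside \<open>solvable\<close>.\<close>
    using that
    by (intro ext) (simp add: diff_spectrum_eq displayed_spectrum_def class_sizes_even flip: q_def)
  moreover have "diff_spectrum F = displayed_spectrum
        [(0, 2 ^ (2 * m - 1) + 2 ^ (m - 1) - 1),
         (2, 2 ^ (2 * m - 1) - 2 ^ (m - 1) - 1),
         (4, 1),
         (2 ^ m - 2, 1)]" if "odd m"
    \<comment> \<open>Here \<open>b = 1\<close> supplies the entry at index \<open>4\<close>
      instead.\<close>
    using that
    by (intro ext) (simp add: diff_spectrum_eq displayed_spectrum_def class_sizes_odd flip: q_def)
  ultimately show ?thesis
    using locally_APN by blast
qed

end
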